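(* Consider repeated play of the symmetric $n$-player game ($n\ge 2$) described in the context. For $j = 1, \dots, n$ let $\ell_j$ be a separation line for the game with positive slope, and assume that at least one of the lines $\ell_1,\dots,\ell_n$ has slope less than $1$. Then there exists a unique point $X \in \mathcal O$ such that, if each player $j$ ($j=1,\dots,n$) eventually uses the simple Smale plan associated with $\ell_j$, then the sequence of time-averaged payoff vectors $\{ s^T \}$ converges in $\mathcal O$ to $X$. Moreover, if each $\ell_j$ passes through the point $(p_n,p_n)$, then $X = (p_n, \dots, p_n)$.
   Context: The game. Fix an integer $n\ge 2$ and real numbers $r_0,\dots,r_{n-1}$ and $p_1,\dots,p_n$. There are $n$ players; in each round each player chooses to cooperate or to defect. When exactly $k$ players cooperate, each cooperator receives $p_k$ (if $k\ge 1$) and each defector receives $r_k$ (if $k\le n-1$). Put $m_0=r_0$, $m_n=p_n$, and $m_k=\frac1n[k\,p_k+(n-k)\,r_k]$ for $1\le k\le n-1$. Standing assumptions: (i) $r_0<r_1<\dots<r_{n-1}$ and $p_1<p_2<\dots<p_n$; (ii) $p_k<r_{k-1}$ for $k=1,\dots,n$; (iii) $m_0<m_1<\dots<m_n$. Repeated play. The game is played in rounds $T=1,2,\dots$; unless a hypothesis says otherwise, the players' choices are arbitrary. Let $S^T\in\mathbb R^n$ be the vector of payoffs in round $T$ and let $s^T=\frac1T\sum_{t=1}^T S^t$. The outcome set $\mathcal O\subset\mathbb R^n$ is the convex hull of the $2^n$ possible one-round payoff vectors. For $x\in\mathbb R^n$ let $\bar\pi(x)=\frac1n\sum_{i=1}^n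 x_i$ and $\Pi_j(x)=(x_j,\bar\pi(x))\in\mathbb R^2$ for $j=1,\dots,n$. Separation lines. The points $(p_k,m_k)$, $k=1,\dots,n$, are the cooperation points and the points $(r_k,m_k)$, $k=0,\dots,n-1$, are the defection points. A point $(x,y)$ is above (resp. on, below) the line with equation $y=\lambda x+b$ if $y-\lambda x-b$ is $>0$ (resp. $=0$, $<0$). A line $\ell\subset\mathbb R^2$ with equation $y=\lambda x+b$ is a separation line for the game if every cooperation point is on or above $\ell$ and every defection point is on or below $\ell$. Simple Smale plans. Given a separation line $\ell$ with positive slope, the simple Smale plan for player $j$ associated with $\ell$ is: in round $T+1$, defect if $\Pi_j(s^T)$ is above $\ell$, and cooperate if $\Pi_j(s^T)$ is on or below $\ell$. A player eventually uses a given simple Smale plan if there is some $T_0$ such that the player's choice in round $T+1$ follows the plan for all $T\ge T_0$. *)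

theory Defs
  imports "HOL-Analysis.Analysis"
begin

text \<open>
  Players are the elements of a finite type \<open>'n\<close>, so \<open>n = CARD('n)\<close>. The choices made in one
  round are given by the set \<open>C\<close> of cooperating players. The payoff tables are functions on
  \<open>nat\<close>; only \<open>r 0, \<dots>, r (n - 1)\<close> and \<open>p 1, \<dots>, p n\<close> are ever used.
\<close>

definition payoff :: "(nat \<Rightarrow> real) \<Rightarrow> (nat \<Rightarrow> real) \<Rightarrow> 'n::finite set \<Rightarrow> real ^ 'n" where
  "payoff r p C = (\<chi> i. if i \<in> C then p (card C) else r (card C))"

definition mean_payoff :: "nat \<Rightarrow> (nat \<Rightarrow> real) \<Rightarrow> (nat \<Rightarrow> real) \<Rightarrow> nat \<Rightarrow> real" where
  "mean_payoff n r p k =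
     (if k = 0 then r 0
      else if k = n then p n
      else (real k * p k + (real n - real k) * r k) / real n)"

definition symmetric_game :: "nat \<Rightarrow> (nat \<Rightarrow> real) \<Rightarrow> (nat \<Rightarrow> real) \<Rightarrow> bool" where
  "symmetric_game n r p \<longleftrightarrow>
     n \<ge> 2 \<and>
     strict_mono_on {0..n - 1} r \<and> strict_mono_on {1..n} p \<and>
     (\<forall>k\<in>{1..n}. p k < r (k - 1)) \<and>
     strict_mono_on {0..n} (mean_payoff n r p)"

definition outcome_set :: "(nat \<Rightarrow> real) \<Rightarrow> (nat \<Rightarrow> real) \<Rightarrow> (real ^ 'n::finite) set" where
  "outcome_set r p = convex hull (range (payoff r p))"

text \<open>
  A play \<open>c\<close> assigns to each round \<open>t = 1, 2, \<dots>\<close> the set of cooperators; \<open>c 0\<close> is never used.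
\<close>

definition avg_payoff ::
  "(nat \<Rightarrow> real) \<Rightarrow> (nat \<Rightarrow> real) \<Rightarrow> (nat \<Rightarrow> 'n::finite set) \<Rightarrow> nat \<Rightarrow> real ^ 'n" where
  "avg_payoff r p c T = (1 / real T) *\<^sub>R (\<Sum>t = 1..T. payoff r p (c t))"

definition coord_mean :: "real ^ 'n::finite \<Rightarrow> real" where
  "coord_mean x = (\<Sum>i\<in>UNIV. x $ i) / real CARD('n)"

definition proj_plane :: "'n::finite \<Rightarrow> real ^ 'n \<Rightarrow> real \<times> real" where
  "proj_plane j x = (x $ j, coord_mean x)"

text \<open>
  A non-vertical line is represented by the slope \<open>\<lambda>\<close> and intercept \<open>b\<close> of its equation
  \<open>y = \<lambda> x + b\<close>, which it determines uniquely.
\<close>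

definition above_line :: "real \<Rightarrow> real \<Rightarrow> real \<times> real \<Rightarrow> bool" where
  "above_line slope b z \<longleftrightarrow> snd z - slope * fst z - b > 0"

definition on_line :: "real \<Rightarrow> real \<Rightarrow> real \<times> real \<Rightarrow> bool" where
  "on_line slope b z \<longleftrightarrow> snd z - slope * fst z - b = 0"

definition below_line :: "real \<Rightarrow> real \<Rightarrow> real \<times> real \<Rightarrow> bool" where
  "below_line slope b z \<longleftrightarrow> snd z - slope * fst z - b < 0"

definition separation_line ::
  "nat \<Rightarrow> (nat \<Rightarrow> real) \<Rightarrow> (nat \<Rightarrow> real) \<Rightarrow> real \<Rightarrow> real \<Rightarrow> bool" where
  "separation_line n r p slope b \<longleftrightarrow>
     (\<forall>k\<in>{1..n}. on_line slope b (p k, mean_payoff n r p k) \<or>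
                  above_line slope b (p k, mean_payoff n r p k)) \<and>
     (\<forall>k\<in>{0..n - 1}. on_line slope b (r k, mean_payoff n r p k) \<or>
                      below_line slope b (r k, mean_payoff n r p k))"

definition follows_smale_plan ::
  "(nat \<Rightarrow> real) \<Rightarrow> (nat \<Rightarrow> real) \<Rightarrow> real \<Rightarrow> real \<Rightarrow> 'n::finite \<Rightarrow> (nat \<Rightarrow> 'n set) \<Rightarrow> nat \<Rightarrow> bool" where
  "follows_smale_plan r p slope b j c T \<longleftrightarrow>
     (let z = proj_plane j (avg_payoff r p c T) in
       (above_line slope b z \<longrightarrow> j \<notin> c (T + 1)) \<and>
       (on_line slope b z \<or> below_line slope b z \<longrightarrow> j \<in> c (T + 1)))"

text \<open>
  The bound \<open>T0 \<ge> 1\<close> is there because the average over zero rounds is meaningless: the choice in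
  round 1 is not prescribed by the plan.
\<close>

definition eventually_uses_smale_plan ::
  "(nat \<Rightarrow> real) \<Rightarrow> (nat \<Rightarrow> real) \<Rightarrow> real \<Rightarrow> real \<Rightarrow> 'n::finite \<Rightarrow> (nat \<Rightarrow> 'n set) \<Rightarrow> bool" where
  "eventually_uses_smale_plan r p slope b j c \<longleftrightarrow>
     (\<exists>T0\<ge>1. \<forall>T\<ge>T0. follows_smale_plan r p slope b j c T)"

text \<open>
  Convergence within the outcome set: the averages (over at least one round) lie in the outcome
  set, and they converge to a point of it.
\<close>

definition converges_in_outcome_set ::
  "(nat \<Rightarrow> real) \<Rightarrow> (nat \<Rightarrow> real) \<Rightarrow> (nat \<Rightarrow> 'n::finite set) \<Rightarrow> real ^ 'n \<Rightarrow> bool" where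
  "converges_in_outcome_set r p c X \<longleftrightarrow>
     X \<in> outcome_set r p \<and>
     (\<forall>T\<ge>1. avg_payoff r p c T \<in> outcome_set r p) \<and>
     avg_payoff r p c \<longlonglongrightarrow> X"

end

theory Submission imports Defs begin

text \<open>
  Write \<open>g\<^sub>j x\<close> for the signed height of \<open>\<Pi>\<^sub>j x\<close> over the line \<open>\<ell>\<^sub>j\<close>; it is affine in \<open>x\<close>, so the
  sums \<open>T * g\<^sub>j s\<^sup>T\<close> grow by \<open>g\<^sub>j\<close> of the payoff vector of each round. Since \<open>\<ell>\<^sub>j\<close> separates, the
  plan makes this increment have the sign opposite to the current sum, so the sums stay bounded
  and \<open>g\<^sub>j s\<^sup>T\<close> tends to 0 for every \<open>j\<close>. Every separation line has slope at most 1, because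
  \<open>(r\<^sub>0, r\<^sub>0)\<close> lies on or below it and \<open>(p\<^sub>n, p\<^sub>n)\<close> on or above it. As one slope is less than 1, the
  linear system \<open>g\<^sub>j x = 0\<close> is nonsingular, so \<open>s\<^sup>T\<close> converges to its unique solution.
\<close>

definition line_gap :: "real \<Rightarrow> real \<Rightarrow> 'n::finite \<Rightarrow> real ^ 'n \<Rightarrow> real" where
  "line_gap l b j x = coord_mean x - l * x $ j - b"

lemma coord_mean_scaleR: "coord_mean (a *\<^sub>R x) = a * coord_mean x"
  by (simp add: coord_mean_def sum_distrib_left)

lemma coord_mean_sum: "coord_mean (\<Sum>t\<in>A. f t) = (\<Sum>t\<in>A. coord_mean (f t))"
  by (simp add: coord_mean_def sum_divide_distrib [symmetric] sum.swap [of _ UNIV A])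

text \<open>Splitting the sum into cooperators and defectors gives the general formula. If nobody or
  everybody cooperates, the table entry outside its range has coefficient 0, in agreement with the
  special cases of \<open>mean_payoff\<close>.\<close>

lemma coord_mean_payoff:
  "coord_mean (payoff r p C :: real ^ 'n::finite) = mean_payoff CARD('n) r p (card C)"
proof -
  let ?n = "CARD('n)"
  have le: "card C \<le> ?n" by (simp add: card_mono)
  have eq: "coord_mean (payoff r p C :: real ^ 'n) =
      (real (card C) * p (card C) + (real ?n - real (card C)) * r (card C)) / real ?n"
    using le by (simp add: coord_mean_def payoff_def sum.If_cases Compl_eq_Diff_UNIV
        card_Diff_subset of_nat_diff)
  then show ?thesis
    by (simp add: mean_payoff_def)
qed

lemma line_gap_avg_payoff:
  assumes "T \<ge> 1"
  shows "real T * line_gap l b j (avg_payoff r p c T) =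
    (\<Sum>t = 1..T. line_gap l b j (payoff r p (c t)))"
  using assms
  by (simp add: line_gap_def avg_payoff_def coord_mean_scaleR coord_mean_sum sum_subtractf
      sum.distrib sum_distrib_left field_simps)

text \<open>The projection of the payoff vector for \<open>j\<close> is a cooperation point if
  \<open>j\<close> cooperates and a defection point otherwise; the choice of \<open>j\<close> also
  keeps \<open>card C\<close> in the matching index range.\<close>

lemma separation_line_gap_payoff:
  fixes C :: "'n::finite set"
  assumes "separation_line CARD('n) r p l b"
  shows "j \<in> C \<Longrightarrow> line_gap l b j (payoff r p C) \<ge> 0"
    and "j \<notin> C \<Longrightarrow> line_gap l b j (payoff r p C) \<le> 0"
proof -
  have gap: "line_gap l b j (payoff r p C) =
      mean_payoff CARD('n) r p (card C) - l * (if j \<in> C then p (card C) else r (card C)) - b"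
    by (simp add: line_gap_def coord_mean_payoff) (simp add: payoff_def)
  show "line_gap l b j (payoff r p C) \<ge> 0" if "j \<in> C"
  proof -
    have "card C \<in> {1..CARD('n)}"
      using that by (auto simp: card_mono Suc_le_eq card_gt_0_iff)
    with assms show ?thesis
      using that unfolding gap separation_line_def on_line_def above_line_def by force
  qed
  show "line_gap l b j (payoff r p C) \<le> 0" if "j \<notin> C"
  proof -
    have "card C < CARD('n)"
      using that by (intro psubset_card_mono) auto
    then have "card C \<in> {0..CARD('n) - 1}" by auto
    with assms show ?thesis
      using that unfolding gap separation_line_def on_line_def below_line_def by force
  qed
qed

text \<open>A step of length at most \<open>M\<close> towards 0 either does not increase the
  absolute value or, starting at 0 or crossing it, ends within \<open>M\<close> of it.\<close>

lemma bounded_of_opposite_increments: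
  fixes a :: "nat \<Rightarrow> real"
  assumes pos: "\<And>t. t \<ge> T0 \<Longrightarrow> a t > 0 \<Longrightarrow> - M \<le> a (Suc t) - a t \<and> a (Suc t) - a t \<le> 0"
    and neg: "\<And>t. t \<ge> T0 \<Longrightarrow> a t \<le> 0 \<Longrightarrow> 0 \<le> a (Suc t) - a t \<and> a (Suc t) - a t \<le> M"
    and "t \<ge> T0"
  shows "\<bar>a t\<bar> \<le> max \<bar>a T0\<bar> M"
  using \<open>t \<ge> T0\<close>
proof (induction t rule: dec_induct)
  case (step t)
  then show ?case
    using pos [of t] neg [of t] by (cases "a t > 0") auto
qed simp

lemma line_gap_tendsto_0:
  fixes j :: "'n::finite"
  assumes sep: "separation_line CARD('n) r p l b"
    and plan: "eventually_uses_smale_plan r p l b j c"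
  shows "(\<lambda>T. line_gap l b j (avg_payoff r p c T)) \<longlonglongrightarrow> 0"
proof -
  define g where "g C = line_gap l b j (payoff r p C)" for C
  define a where "a T = (\<Sum>t = 1..T. g (c t))" for T
  \<comment> \<open>Only finitely many payoff vectors exist, so one bound serves for all
    increments.\<close>
  define M where "M = Max (range (\<lambda>C. \<bar>g C\<bar>))"
  have M: "\<bar>g C\<bar> \<le> M" for C
    unfolding M_def by (rule Max_ge) auto
  obtain T0 where "T0 \<ge> 1" and T0: "\<And>T. T \<ge> T0 \<Longrightarrow> follows_smale_plan r p l b j c T"
    using plan by (auto simp: eventually_uses_smale_plan_def)
  have avg: "real T * line_gap l b j (avg_payoff r p c T) = a T" if "T \<ge> 1" for T
    using line_gap_avg_payoff [OF that] by (simp add: a_def g_def)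
  have inc: "a (Suc T) - a T = g (c (Suc T))" for T
    by (simp add: a_def)
  \<comment> \<open>Multiplying by \<open>T > 0\<close> keeps the sign, so the plan in effect reads
    the sign of \<open>a T\<close>; the tie \<open>a T = 0\<close> counts as cooperation.\<close>
  have coop: "a T > 0 \<longleftrightarrow> j \<notin> c (Suc T)" if "T \<ge> T0" for T
  proof -
    have "T > 0" using that \<open>T0 \<ge> 1\<close> by simp
    then have "a T > 0 \<longleftrightarrow> line_gap l b j (avg_payoff r p c T) > 0"
      by (simp add: zero_less_mult_iff flip: avg)
    then show ?thesis
      using T0 [OF that]
      by (auto simp: follows_smale_plan_def proj_plane_def line_gap_def Let_def
          above_line_def on_line_def below_line_def not_less le_less)
  qed
  have bound: "\<bar>a T\<bar> \<le> max \<bar>a T0\<bar> M" if "T \<ge> T0" for T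
  proof (rule bounded_of_opposite_increments [OF _ _ that])
    fix t assume "t \<ge> T0" "a t > 0"
    then show "- M \<le> a (Suc t) - a t \<and> a (Suc t) - a t \<le> 0"
      using coop [of t] separation_line_gap_payoff(2) [OF sep, of j "c (Suc t)"] M [of "c (Suc t)"]
      by (auto simp: inc g_def)
  next
    fix t assume "t \<ge> T0" "a t \<le> 0"
    then show "0 \<le> a (Suc t) - a t \<and> a (Suc t) - a t \<le> M"
      using coop [of t] separation_line_gap_payoff(1) [OF sep, of j "c (Suc t)"] M [of "c (Suc t)"]
      by (auto simp: inc g_def)
  qed
  show ?thesis
  proof (rule Lim_null_comparison)
    show "\<forall>\<^sub>F T in sequentially.
        norm (line_gap l b j (avg_payoff r p c T)) \<le> max \<bar>a T0\<bar> M / real T"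
      using eventually_ge_at_top [of T0]
    proof eventually_elim
      case (elim T)
      then have "T \<ge> 1" using \<open>T0 \<ge> 1\<close> by simp
      then have "line_gap l b j (avg_payoff r p c T) = a T / real T"
        using avg [of T] by (simp add: field_simps)
      then show ?case
        using bound [OF elim] by (simp add: divide_right_mono)
    qed
    show "(\<lambda>T. max \<bar>a T0\<bar> M / real T) \<longlonglongrightarrow> 0"
      by (rule lim_const_over_n)
  qed
qed

text \<open>The extreme points for 0 and \<open>n\<close> cooperators lie on the diagonal, and
  \<open>r 0 < p n\<close>. A line that is on or above the first and on or below the second rises at
  most as fast as the diagonal.\<close>

lemma separation_line_slope_le_1:
  assumes "symmetric_game n r p" "separation_line n r p l b"
  shows "l \<le> 1"
proof -
  have n: "n \<ge> 2" and mono: "strict_mono_on {0..n} (mean_payoff n r p)"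
    using assms(1) by (auto simp: symmetric_game_def)
  have "mean_payoff n r p 0 < mean_payoff n r p n"
    using n by (intro strict_mono_onD [OF mono]) auto
  then have less: "r 0 < p n"
    using n by (simp add: mean_payoff_def)
  have "n \<in> {1..n}" "0 \<in> {0..n - 1}" using n by auto
  with assms(2) have "on_line l b (p n, mean_payoff n r p n) \<or> above_line l b (p n, mean_payoff n r p n)"
    "on_line l b (r 0, mean_payoff n r p 0) \<or> below_line l b (r 0, mean_payoff n r p 0)"
    unfolding separation_line_def by blast+
  then have "p n \<ge> l * p n + b" "r 0 \<le> l * r 0 + b"
    using n by (auto simp: mean_payoff_def on_line_def above_line_def below_line_def)
  then have "l * (p n - r 0) \<le> 1 * (p n - r 0)"
    by (simp add: algebra_simps)
  with less show ?thesis
    by (simp only: mult_le_cancel_right)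
qed

lemma avg_payoff_in_outcome_set:
  assumes "T \<ge> 1"
  shows "avg_payoff r p c T \<in> outcome_set r p"
proof -
  have "(\<Sum>t = 1..T. (1 / real T) *\<^sub>R payoff r p (c t)) \<in> convex hull range (payoff r p)"
    using assms by (intro convex_sum) (auto intro: hull_inc)
  then show ?thesis
    by (simp add: avg_payoff_def outcome_set_def scaleR_sum_right)
qed

lemma closed_outcome_set: "closed (outcome_set r p)"
  unfolding outcome_set_def
  by (simp add: compact_imp_closed compact_convex_hull finite_imp_compact)

text \<open>Convergence of all such plays says something about the limit only if there is one: this
  play puts the limit in the outcome set and makes it unique.\<close>

lemma smale_play_exists:
  "\<exists>c. \<forall>j. eventually_uses_smale_plan r p (slope j) (b j) (j :: 'n::finite) c"
proof -
  define coop where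
    "coop T s = {j. line_gap (slope j) (b j) j ((1 / real T) *\<^sub>R s) \<le> 0}" for T and s :: "real ^ 'n"
  \<comment> \<open>The plans depend on the past only through the sum of payoffs, so the recursion
    carries that sum instead of the choices.\<close>
  define total where
    "total = rec_nat (0 :: real ^ 'n) (\<lambda>T s. s + payoff r p (coop T s))"
  define c where "c T = coop (T - 1) (total (T - 1))" for T
  have total: "total T = (\<Sum>t = 1..T. payoff r p (c t))" for T
    by (induction T) (simp_all add: total_def c_def)
  have c: "c (Suc T) = {j. line_gap (slope j) (b j) j (avg_payoff r p c T) \<le> 0}" for T
    by (simp only: c_def [of "Suc T"] diff_Suc_1 total coop_def avg_payoff_def)
  have "follows_smale_plan r p (slope j) (b j) j c T" for j T
    by (auto simp: follows_smale_plan_def c line_gap_def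
        proj_plane_def Let_def above_line_def on_line_def below_line_def)
  then show ?thesis
    unfolding eventually_uses_smale_plan_def by blast
qed

text \<open>Solving each gap for \<open>x $ j\<close> and summing over \<open>j\<close> eliminates
  the coordinates, since they add up to \<open>CARD('n)\<close> times the mean; one equation for the
  mean remains.\<close>

lemma coord_mean_eq_line_gaps:
  fixes x :: "real ^ 'n::finite"
  assumes "\<And>j. slope j \<noteq> 0"
  shows "(\<Sum>j\<in>UNIV. 1 / slope j - 1) * coord_mean x =
    (\<Sum>j\<in>UNIV. (b j + line_gap (slope j) (b j) j x) / slope j)"
proof -
  have "(\<Sum>j\<in>UNIV. (b j + line_gap (slope j) (b j) j x) / slope j)
      = (\<Sum>j\<in>UNIV. 1 / slope j * coord_mean x - x $ j)"
    using assms by (intro sum.cong) (simp_all add: line_gap_def field_simps)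
  also have "\<dots> = (\<Sum>j\<in>UNIV. 1 / slope j * coord_mean x) - real CARD('n) * coord_mean x"
    by (simp add: sum_subtractf coord_mean_def)
  finally show ?thesis
    by (simp add: sum_subtractf sum_distrib_right left_diff_distrib)
qed

theorem corollary4p3:
  fixes r p :: "nat \<Rightarrow> real"
    and slope b :: "'n::finite \<Rightarrow> real"
  assumes "symmetric_game CARD('n) r p"
    and "\<And>j. separation_line CARD('n) r p (slope j) (b j)"
    and "\<And>j. slope j > 0"
    and "\<exists>j. slope j < 1"
  shows "\<exists>X :: real ^ 'n.
           (X \<in> outcome_set r p \<and>
            (\<forall>c. (\<forall>j. eventually_uses_smale_plan r p (slope j) (b j) j c) \<longrightarrow>
                 converges_in_outcome_set r p c X)) \<and>
           (\<forall>Y \<in> outcome_set r p.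
              (\<forall>c. (\<forall>j. eventually_uses_smale_plan r p (slope j) (b j) j c) \<longrightarrow>
                   converges_in_outcome_set r p c Y) \<longrightarrow> Y = X) \<and>
           ((\<forall>j. on_line (slope j) (b j) (p CARD('n), p CARD('n))) \<longrightarrow>
              X = (\<chi> i. p CARD('n)))"
proof -
  define gap where "gap j = line_gap (slope j) (b j) j" for j
  define K where "K = (\<Sum>j\<in>UNIV. 1 / slope j - 1)"
  \<comment> \<open>The right side of \<open>solve\<close> below with every gap set to 0. The
    literal \<open>+ 0\<close> and \<open>- 0\<close> give the limit the shape that
    \<open>tendsto_intros\<close> produces.\<close>
  define X :: "real ^ 'n" where
    "X = (\<chi> j. ((\<Sum>i\<in>UNIV. (b i + 0) / slope i) / K - b j - 0) / slope j)"
  have nz: "slope j \<noteq> 0" for j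
    using assms(3) [of j] by simp
  have le1: "slope j \<le> 1" for j
    using separation_line_slope_le_1 [OF assms(1,2)] .
  obtain j0 where "slope j0 < 1" using assms(4) by blast
  \<comment> \<open>All summands are nonnegative because slopes are at most 1, and the one at
    \<open>j0\<close> is positive.\<close>
  then have "K > 0"
    unfolding K_def using assms(3) le1 by (intro sum_pos2 [of _ j0]) auto
  \<comment> \<open>Dividing by \<open>K\<close> recovers the mean, so a point is a continuous
    function of its gaps.\<close>
  have solve: "x $ j = ((\<Sum>i\<in>UNIV. (b i + gap i x) / slope i) / K - b j - gap j x) / slope j"
    for x :: "real ^ 'n" and j
  proof -
    have "K * coord_mean x = (\<Sum>i\<in>UNIV. (b i + gap i x) / slope i)"
      unfolding K_def gap_def using nz by (rule coord_mean_eq_line_gaps)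
    then have "(\<Sum>i\<in>UNIV. (b i + gap i x) / slope i) / K = coord_mean x"
      using \<open>K > 0\<close> by (simp add: field_simps)
    then show ?thesis
      using nz [of j] by (simp only:) (simp add: gap_def line_gap_def)
  qed
  have conv: "converges_in_outcome_set r p c X"
    if plan: "\<And>j. eventually_uses_smale_plan r p (slope j) (b j) j c" for c
  proof -
    have "(\<lambda>T. gap j (avg_payoff r p c T)) \<longlonglongrightarrow> 0" for j
      unfolding gap_def using line_gap_tendsto_0 [OF assms(2) plan] .
    then have "(\<lambda>T. avg_payoff r p c T $ j) \<longlonglongrightarrow> X $ j" for j
      unfolding solve [of "avg_payoff r p c _"] X_def vec_lambda_beta
      using \<open>K > 0\<close> nz by (intro tendsto_intros) auto
    then have lim: "avg_payoff r p c \<longlonglongrightarrow> X"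
      by (rule vec_tendstoI)
    moreover have "X \<in> outcome_set r p"
    proof (rule Lim_in_closed_set [OF closed_outcome_set _ _ lim])
      show "\<forall>\<^sub>F T in sequentially. avg_payoff r p c T \<in> outcome_set r p"
        using eventually_ge_at_top [of 1] by eventually_elim (rule avg_payoff_in_outcome_set)
    qed simp
    ultimately show ?thesis
      by (simp add: converges_in_outcome_set_def avg_payoff_in_outcome_set)
  qed
  obtain c0 where c0: "\<And>j. eventually_uses_smale_plan r p (slope j) (b j) j c0"
    using smale_play_exists by blast
  show ?thesis
  proof (intro exI [of _ X] conjI ballI impI allI)
    show "X \<in> outcome_set r p"
      using conv [OF c0] by (simp add: converges_in_outcome_set_def)
    show "converges_in_outcome_set r p c X"
      if "\<forall>j. eventually_uses_smale_plan r p (slope j) (b j) j c" for c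
      using conv that by blast
    show "Y = X"
      if "\<forall>c. (\<forall>j. eventually_uses_smale_plan r p (slope j) (b j) j c) \<longrightarrow>
                   converges_in_outcome_set r p c Y" for Y
      using that c0 conv [OF c0] LIMSEQ_unique unfolding converges_in_outcome_set_def by blast
    show "X = (\<chi> i. p CARD('n))"
      if "\<forall>j. on_line (slope j) (b j) (p CARD('n), p CARD('n))"
    proof -
      \<comment> \<open>Every projection of the constant vector is the common point of the lines, so
        all gaps vanish and \<open>solve\<close> identifies the vector with
        \<open>X\<close>.\<close>
      have "gap j (\<chi> i. p CARD('n)) = 0" for j
        using that by (simp add: gap_def line_gap_def coord_mean_def on_line_def)
      then show ?thesis
        using solve [of "\<chi> i. p CARD('n)"] by (simp add: X_def vec_eq_iff)
    qed
  qed
qed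

end
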